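(* If a period matrix $\Omega_\tau=\iota_*(\tau)$, $\tau\in\mathbb{H}_1$, in the image of $\iota_*$ is diagonalizable by a symplectic transformation (i.e. there is $\begin{pmatrix}A&B\\C&D\end{pmatrix}\in Sp(2;\mathbb{Z})$ such that $(A\Omega_\tau+B)(C\Omega_\tau+D)^{-1}$ is a diagonal matrix), then it is $G$-equivalent to the base point $\iota_*(i)$, i.e. there is $g\in G$ with $\iota_*(g\cdot\tau)=\iota_*(i)$.
   Context: $\mathbb{H}_1$ is the upper half plane; $\mathbb{S}_2$ is the Siegel space of symmetric complex $2\times2$ matrices with positive-definite imaginary part. $Sp(2;\mathbb{Z})$ is the group of integral $4\times 4$ matrices preserving the skew form $\begin{pmatrix}0&\mathbb{1}\\-\mathbb{1}&0\end{pmatrix}$ ($\mathbb 1$ the $2\times2$ unit matrix); it acts on $\mathbb{S}_2$ by $\begin{pmatrix}A&B\\C&D\end{pmatrix}\cdot\Omega=(A\Omega+B)(C\Omega+D)^{-1}$. $U(1,1;\mathbb{Z}[i])$ is the group of matrices $g$ with entries in $\mathbb{Z}[i]$ satisfying $\bar g^{tr}Hg=H$, $H=\mathrm{diag}(1,-1)$. Put $g_0=\frac{1}{\sqrt2}\begin{pmatrix}1&i\\ i&1\end{pmatrix}$ and $G=g_0\,U(1,1;\mathbb{Z}[i])\,g_0^{-1}\subset GL_2(\mathbb{C})$, acting on $\mathbb{H}_1$ by fractional linear transformations. The embedding $\iota_*\colon\mathbb{H}_1\to\mathbb{S}_2$ is $$\iota_*(\tau)=\Omega_\tau=\begin{pmatrix}\frac{\tau}{2}&\frac12\\\frac12&\frac{\tau}{2}\end{pmatrix},$$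 and $G$ acts on the image of $\iota_*$ by $g\cdot\iota_*(\tau)=\iota_*(g\cdot\tau)$. *)

theory Defs
  imports "HOL-Analysis.Analysis"
begin

definition upper_half_plane :: "complex set" where
  "upper_half_plane = {\<tau>. Im \<tau> > 0}"

definition siegel_space :: "(complex^2^2) set" where
  "siegel_space = {\<Omega>. transpose \<Omega> = \<Omega> \<and> (\<forall>v::real^2. v \<noteq> 0 \<longrightarrow> v \<bullet> (map_matrix Im \<Omega> *v v) > 0)}"

(* 4x4 matrices are indexed by the four-element sum type 2 + 2, so that the
   2x2 blocks are given by the summands of the index type. *)

definition block_matrix ::
  "'a^2^2 \<Rightarrow> 'a^2^2 \<Rightarrow> 'a^2^2 \<Rightarrow> 'a^2^2 \<Rightarrow> 'a^(2 + 2)^(2 + 2)" where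
  "block_matrix A B C D = (\<chi> i j.
     (case i of
        Inl k \<Rightarrow> (case j of Inl l \<Rightarrow> A $ k $ l | Inr l \<Rightarrow> B $ k $ l)
      | Inr k \<Rightarrow> (case j of Inl l \<Rightarrow> C $ k $ l | Inr l \<Rightarrow> D $ k $ l)))"

definition symplectic_form :: "int^(2 + 2)^(2 + 2)" where
  "symplectic_form = block_matrix 0 (mat 1) (- mat 1) 0"

definition Sp2Z :: "(int^(2 + 2)^(2 + 2)) set" where
  "Sp2Z = {M. transpose M ** symplectic_form ** M = symplectic_form}"

(* (A \<Omega> + B) (C \<Omega> + D)^(-1); the second factor is invertible whenever the block
   matrix is symplectic and \<Omega> lies in the Siegel space. *)
definition symplectic_action ::
  "int^2^2 \<Rightarrow> int^2^2 \<Rightarrow> int^2^2 \<Rightarrow> int^2^2 \<Rightarrow> complex^2^2 \<Rightarrow> complex^2^2" where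
  "symplectic_action A B C D \<Omega> =
     (map_matrix of_int A ** \<Omega> + map_matrix of_int B) **
     matrix_inv (map_matrix of_int C ** \<Omega> + map_matrix of_int D)"

definition diagonal_matrix :: "'a::zero^'n^'n \<Rightarrow> bool" where
  "diagonal_matrix M \<longleftrightarrow> (\<forall>i j. i \<noteq> j \<longrightarrow> M $ i $ j = 0)"

definition gaussian_integers :: "complex set" where
  "gaussian_integers = {z. Re z \<in> \<int> \<and> Im z \<in> \<int>}"

definition H11 :: "complex^2^2" where
  "H11 = vector [vector [1, 0], vector [0, -1]]"

definition U11_gaussian :: "(complex^2^2) set" where
  "U11_gaussian = {g. (\<forall>i j. g $ i $ j \<in> gaussian_integers) \<and>
                      transpose (map_matrix cnj g) ** H11 ** g = H11}"

definition g0 :: "complex^2^2" where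
  "g0 = (1 / sqrt 2) *\<^sub>R vector [vector [1, \<i>], vector [\<i>, 1]]"

definition G :: "(complex^2^2) set" where
  "G = {g0 ** u ** matrix_inv g0 | u. u \<in> U11_gaussian}"

definition frac_linear :: "complex^2^2 \<Rightarrow> complex \<Rightarrow> complex" where
  "frac_linear g = moebius (g $ 1 $ 1) (g $ 1 $ 2) (g $ 2 $ 1) (g $ 2 $ 2)"

definition iota :: "complex \<Rightarrow> complex^2^2" where
  "iota \<tau> = vector [vector [\<tau> / 2, 1 / 2], vector [1 / 2, \<tau> / 2]]"

lemma iota_in_siegel_space:
  assumes "\<tau> \<in> upper_half_plane"
  shows "iota \<tau> \<in> siegel_space"
proof -
  have sym: "transpose (iota \<tau>) = iota \<tau>"
    by (simp add: iota_def transpose_def vec_eq_iff forall_2)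
  have "v \<bullet> (map_matrix Im (iota \<tau>) *v v) > 0" if "v \<noteq> 0" for v :: "real^2"
  proof -
    have "v \<bullet> (map_matrix Im (iota \<tau>) *v v) = Im \<tau> / 2 * (v \<bullet> v)"
      by (simp add: iota_def inner_vec_def matrix_vector_mult_def sum_2 field_simps)
    also have "\<dots> > 0"
      using that assms by (intro mult_pos_pos) (simp_all add: upper_half_plane_def)
    finally show ?thesis .
  qed
  with sym show ?thesis
    by (simp add: siegel_space_def)
qed

lemma matrix_inv_eqI:
  fixes A :: "'a::semiring_1^'n^'m"
  assumes "A ** B = mat 1" and "B ** A = mat 1"
  shows "matrix_inv A = B"
proof -
  have "A ** matrix_inv A = mat 1 \<and> matrix_inv A ** A = mat 1"
    unfolding matrix_inv_def by (rule someI[of _ B]) (simp add: assms)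
  then have "matrix_inv A = (B ** A) ** matrix_inv A" and "A ** matrix_inv A = mat 1"
    by (simp_all add: assms)
  then show ?thesis
    by (metis matrix_mul_assoc matrix_mul_rid)
qed

lemma matrix_inv_g0:
  "matrix_inv g0 = (1 / sqrt 2) *\<^sub>R vector [vector [1, - \<i>], vector [- \<i>, 1]]"
  by (rule matrix_inv_eqI)
    (simp_all add: g0_def vec_eq_iff forall_2 matrix_matrix_mult_def sum_2 mat_def complex_eq_iff)

end

theory Submission
  imports Defs
begin

text \<open>
  A period matrix that a symplectic transformation makes diagonal lies on the Humbert surface of
  discriminant \<open>1\<close>: its entries satisfy an integral relation
  \<open>a \<Omega>\<^sub>1\<^sub>1 + b \<Omega>\<^sub>1\<^sub>2 + c \<Omega>\<^sub>2\<^sub>2 + d (\<Omega>\<^sub>1\<^sub>2\<^sup>2 - \<Omega>\<^sub>1\<^sub>1 \<Omega>\<^sub>2\<^sub>2) + e = 0\<close> with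
  \<open>b\<^sup>2 - 4ac - 4de = 1\<close> (\<open>diagonalizable_imp_singular_relation\<close>). The coefficients are the
  Pluecker coordinates of two rows of the symplectic matrix, and the discriminant is the square of
  the symplectic pairing of these rows.

  On the image of \<open>iota\<close> the relation is a quadratic equation for \<open>\<tau>\<close>, whose discriminant is
  \<open>4 ((a - c)\<^sup>2 + (b + d)\<^sup>2 - 1)\<close>. Since \<open>\<tau>\<close> is not real, this is negative, so \<open>c = a\<close> and \<open>b = -d\<close>,
  and \<open>\<tau>\<close> is a root of an integral form \<open>d \<tau>\<^sup>2 - 4a \<tau> + f\<close> with \<open>d f = 4a\<^sup>2 + 1\<close>
  (\<open>singular_relation_iota\<close>). The middle coefficient is divisible by \<open>4\<close>, which singles out one of
  the two classes into which the theta group divides the positive forms of discriminant \<open>-4\<close>. Reduction with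
  the generators \<open>\<tau> + 2\<close> and \<open>-1/\<tau>\<close> of the theta group preserves this divisibility and ends
  at \<open>\<i>\<close> (\<open>theta_group_reduction\<close>). Finally, conjugation by \<open>g0\<close> carries a subgroup of
  \<open>U(1,1)\<close> over the Gaussian integers onto the theta group (\<open>theta_group_subset_G\<close>).
\<close>

section \<open>Block matrices\<close>

lemma sum_UNIV_Plus:
  fixes f :: "'a::finite + 'b::finite \<Rightarrow> 'c::comm_monoid_add"
  shows "sum f UNIV = (\<Sum>i\<in>UNIV. f (Inl i)) + (\<Sum>i\<in>UNIV. f (Inr i))"
  by (simp add: UNIV_Plus_UNIV[symmetric] sum.Plus del: UNIV_Plus_UNIV)

lemma block_matrix_mult:
  fixes A :: "'a::comm_semiring_1^2^2"
  shows "block_matrix A B C D ** block_matrix A' B' C' D' =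
    block_matrix (A ** A' + B ** C') (A ** B' + B ** D') (C ** A' + D ** C') (C ** B' + D ** D')"
  by (simp add: vec_eq_iff block_matrix_def matrix_matrix_mult_def sum_UNIV_Plus split: sum.split)

lemma transpose_block_matrix:
  "transpose (block_matrix A B C D) =
     block_matrix (transpose A) (transpose C) (transpose B) (transpose D)"
  by (simp add: vec_eq_iff block_matrix_def transpose_def split: sum.split)

lemma block_matrix_eq_iff:
  "block_matrix A B C D = block_matrix A' B' C' D' \<longleftrightarrow> A = A' \<and> B = B' \<and> C = C' \<and> D = D'"
  by (auto simp: vec_eq_iff block_matrix_def split_sum_all split: sum.split)

lemma mat_1_block_matrix: "mat 1 = block_matrix (mat 1) 0 0 (mat 1)"
  by (simp add: vec_eq_iff block_matrix_def mat_def split: sum.split)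

lemma matrix_mult_minus_left:
  fixes A :: "'a::ring_1^'n^'m"
  shows "(- A) ** B = - (A ** B)"
  by (simp add: vec_eq_iff matrix_matrix_mult_def sum_negf)

lemma matrix_mult_minus_right:
  fixes A :: "'a::ring_1^'n^'m"
  shows "A ** (- B) = - (A ** B)"
  by (simp add: vec_eq_iff matrix_matrix_mult_def sum_negf)

lemma matrix_mult_add_left:
  fixes A :: "'a::semiring_1^'n^'m"
  shows "(A + B) ** C = A ** C + B ** C"
  by (simp add: vec_eq_iff matrix_matrix_mult_def sum.distrib distrib_right)

lemma map_matrix_of_int_mult:
  "map_matrix of_int (A ** B) = map_matrix of_int A ** (map_matrix of_int B :: 'a::comm_ring_1^'n^'m)"
  by (simp add: vec_eq_iff matrix_matrix_mult_def)

lemma map_matrix_of_int_diff: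
  "map_matrix of_int (A - B) = map_matrix of_int A - (map_matrix of_int B :: 'a::comm_ring_1^'n^'m)"
  by (simp add: vec_eq_iff)

lemma map_matrix_of_int_transpose:
  "map_matrix of_int (transpose A) = transpose (map_matrix of_int A)"
  by (simp add: vec_eq_iff transpose_def)

lemma map_matrix_of_int_mat_1: "map_matrix of_int (mat 1) = (mat 1 :: 'a::comm_ring_1^'n^'n)"
  by (simp add: vec_eq_iff mat_def)

section \<open>Symplectic matrices and the Siegel space\<close>

lemma symplectic_blocks:
  assumes "block_matrix A B C D \<in> Sp2Z"
  shows "transpose A ** C = transpose C ** A"
    and "transpose B ** D = transpose D ** B"
    and "transpose A ** D - transpose C ** B = mat 1"
    and "transpose D ** A - transpose B ** C = mat 1"
  using assms
  by (auto simp: Sp2Z_def symplectic_form_def transpose_block_matrix block_matrix_mult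
      block_matrix_eq_iff matrix_mult_minus_left matrix_mult_minus_right algebra_simps)

text \<open>
  The transpose of a symplectic matrix is symplectic: the relations between the columns exhibit a
  left inverse, which over a field is also a right inverse, and this gives the relations between
  the rows.
\<close>

lemma symplectic_rows:
  assumes "block_matrix A B C D \<in> Sp2Z"
  shows "A ** transpose D - B ** transpose C = mat 1"
proof -
  let ?c = "map_matrix of_int :: int^2^2 \<Rightarrow> real^2^2"
  note blocks = symplectic_blocks[OF assms, THEN arg_cong[where f = ?c],
    unfolded map_matrix_of_int_mult map_matrix_of_int_diff map_matrix_of_int_transpose
      map_matrix_of_int_mat_1]
  have "block_matrix (transpose (?c D)) (- transpose (?c B)) (- transpose (?c C)) (transpose (?c A))
      ** block_matrix (?c A) (?c B) (?c C) (?c D) = mat 1"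
    using blocks
    by (simp add: block_matrix_mult mat_1_block_matrix block_matrix_eq_iff
        matrix_mult_minus_left matrix_mult_minus_right)
  then have "block_matrix (?c A) (?c B) (?c C) (?c D)
      ** block_matrix (transpose (?c D)) (- transpose (?c B)) (- transpose (?c C)) (transpose (?c A))
      = mat 1"
    by (simp add: matrix_left_right_inverse)
  then have "?c (A ** transpose D - B ** transpose C) = ?c (mat 1)"
    by (simp add: block_matrix_mult mat_1_block_matrix block_matrix_eq_iff matrix_mult_minus_right
        map_matrix_of_int_mult map_matrix_of_int_diff map_matrix_of_int_transpose map_matrix_of_int_mat_1)
  then show ?thesis
    by (simp add: vec_eq_iff del: of_int_diff)
qed

definition adjoint_matrix :: "complex^'n^'m \<Rightarrow> complex^'m^'n" where
  "adjoint_matrix M = transpose (map_matrix cnj M)"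

lemma adjoint_matrix_mult: "adjoint_matrix (M ** N) = adjoint_matrix N ** adjoint_matrix M"
  by (simp add: adjoint_matrix_def vec_eq_iff transpose_def matrix_matrix_mult_def mult.commute)

lemma adjoint_matrix_add: "adjoint_matrix (M + N) = adjoint_matrix M + adjoint_matrix N"
  by (simp add: adjoint_matrix_def vec_eq_iff transpose_def)

lemma adjoint_matrix_of_int:
  "adjoint_matrix (map_matrix of_int M) = map_matrix of_int (transpose M)"
  by (simp add: adjoint_matrix_def vec_eq_iff transpose_def)

text \<open>
  A symplectic matrix is real and preserves the skew form, so it preserves the associated skew-Hermitian
  form on pairs of columns. Here this is applied to \<open>(\<Omega>, 1)\<close> and its image \<open>(X, N)\<close>.
\<close>

lemma symplectic_hermitian_form:
  fixes \<Omega> :: "complex^2^2"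
  assumes "block_matrix A B C D \<in> Sp2Z"
  defines "X \<equiv> map_matrix of_int A ** \<Omega> + map_matrix of_int B"
    and "N \<equiv> map_matrix of_int C ** \<Omega> + map_matrix of_int D"
  shows "adjoint_matrix N ** X - adjoint_matrix X ** N = \<Omega> - adjoint_matrix \<Omega>"
proof -
  let ?c = "map_matrix of_int :: int^2^2 \<Rightarrow> complex^2^2"
  let ?O = "adjoint_matrix \<Omega>"
  note blocks = symplectic_blocks[OF assms(1), THEN arg_cong[where f = ?c],
    unfolded map_matrix_of_int_mult map_matrix_of_int_diff map_matrix_of_int_mat_1]
  have AD: "?c (transpose A) ** ?c D = mat 1 + ?c (transpose C) ** ?c B"
    and DA: "?c (transpose D) ** ?c A = mat 1 + ?c (transpose B) ** ?c C"
    using blocks(3,4) by (simp_all add: algebra_simps)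
  have "adjoint_matrix N ** X =
      ?O ** (?c (transpose C) ** ?c A) ** \<Omega> + ?O ** (?c (transpose C) ** ?c B)
      + (?c (transpose D) ** ?c A) ** \<Omega> + ?c (transpose D) ** ?c B"
    unfolding N_def X_def
    by (simp add: adjoint_matrix_add adjoint_matrix_mult adjoint_matrix_of_int
        matrix_add_ldistrib matrix_mult_add_left matrix_mul_assoc)
  moreover have "adjoint_matrix X ** N =
      ?O ** (?c (transpose A) ** ?c C) ** \<Omega> + ?O ** (?c (transpose A) ** ?c D)
      + (?c (transpose B) ** ?c C) ** \<Omega> + ?c (transpose B) ** ?c D"
    unfolding N_def X_def
    by (simp add: adjoint_matrix_add adjoint_matrix_mult adjoint_matrix_of_int
        matrix_add_ldistrib matrix_mult_add_left matrix_mul_assoc)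
  ultimately show ?thesis
    by (simp add: AD DA blocks(1,2) matrix_add_ldistrib matrix_mult_add_left)
qed

text \<open>
  \<open>\<Omega> - \<Omega>\<^sup>*\<close> is \<open>2\<i>\<close> times the imaginary part of \<open>\<Omega>\<close>, a real symmetric positive definite
  matrix. The form it defines takes at \<open>v = x + \<i> y\<close> the sum of its values at \<open>x\<close> and at \<open>y\<close>.
\<close>

lemma siegel_space_hermitian_definite:
  assumes "\<Omega> \<in> siegel_space"
    and "(\<Sum>i\<in>UNIV. cnj (v $ i) * ((\<Omega> - adjoint_matrix \<Omega>) *v v) $ i) = 0"
  shows "v = 0"
proof (rule ccontr)
  assume "v \<noteq> 0"
  define x y :: "real^2" where "x = (\<chi> i. Re (v $ i))" and "y = (\<chi> i. Im (v $ i))"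
  have sym: "\<Omega> $ 2 $ 1 = \<Omega> $ 1 $ 2"
    using assms(1) by (auto simp: siegel_space_def transpose_def vec_eq_iff)
  have pos: "u \<bullet> (map_matrix Im \<Omega> *v u) > 0" if "u \<noteq> 0" for u :: "real^2"
    using assms(1) that by (simp add: siegel_space_def)
  have nonneg: "u \<bullet> (map_matrix Im \<Omega> *v u) \<ge> 0" for u :: "real^2"
    using pos[of u] by (cases "u = 0") auto
  have "x \<noteq> 0 \<or> y \<noteq> 0"
    using \<open>v \<noteq> 0\<close> by (auto simp: x_def y_def vec_eq_iff complex_eq_iff)
  then have "x \<bullet> (map_matrix Im \<Omega> *v x) + y \<bullet> (map_matrix Im \<Omega> *v y) > 0"
    using pos nonneg by (metis add_nonneg_pos add_pos_nonneg)
  moreover have "Im (\<Sum>i\<in>UNIV. cnj (v $ i) * ((\<Omega> - adjoint_matrix \<Omega>) *v v) $ i) =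
      2 * (x \<bullet> (map_matrix Im \<Omega> *v x) + y \<bullet> (map_matrix Im \<Omega> *v y))"
    by (simp add: x_def y_def adjoint_matrix_def transpose_def matrix_vector_mult_def inner_vec_def
        sum_2 sym algebra_simps)
  ultimately show False
    using assms(2) by simp
qed

text \<open>
  A kernel vector \<open>v\<close> of the denominator \<open>N\<close> makes \<open>v\<^sup>* (N\<^sup>* X - X\<^sup>* N) v\<close> vanish, so the Hermitian
  form of \<open>\<Omega> - \<Omega>\<^sup>*\<close> vanishes at \<open>v\<close> and definiteness forces \<open>v = 0\<close>.
\<close>

lemma symplectic_denominator_invertible:
  fixes \<Omega> :: "complex^2^2"
  assumes "block_matrix A B C D \<in> Sp2Z" and "\<Omega> \<in> siegel_space"
  shows "invertible (map_matrix of_int C ** \<Omega> + map_matrix of_int D)" (is "invertible ?N")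
proof -
  let ?X = "map_matrix of_int A ** \<Omega> + map_matrix of_int B"
  have "v = 0" if "?N *v v = 0" for v
  proof (rule siegel_space_hermitian_definite[OF assms(2)])
    have "(\<Omega> - adjoint_matrix \<Omega>) *v v = adjoint_matrix ?N *v (?X *v v)"
      unfolding symplectic_hermitian_form[OF assms(1), symmetric]
      using that by (simp add: matrix_vector_mult_diff_rdistrib matrix_vector_mul_assoc[symmetric])
    moreover have "(\<Sum>i\<in>UNIV. cnj (v $ i) * (adjoint_matrix M *v w) $ i) =
        (\<Sum>i\<in>UNIV. cnj ((M *v v) $ i) * w $ i)" for M :: "complex^2^2" and w
      by (simp add: adjoint_matrix_def transpose_def matrix_vector_mult_def sum_2 algebra_simps)
    ultimately show "(\<Sum>i\<in>UNIV. cnj (v $ i) * ((\<Omega> - adjoint_matrix \<Omega>) *v v) $ i) = 0"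
      using that by simp
  qed
  then show ?thesis
    by (simp add: invertible_left_inverse matrix_left_invertible_ker)
qed

section \<open>The singular relation of discriminant one\<close>

text \<open>
  If \<open>X N\<^sup>-\<^sup>1\<close> is diagonal, the first rows of \<open>X\<close> and \<open>N\<close> are proportional. They are the products
  of the first and third rows of the symplectic matrix with the \<open>4\<close> by \<open>2\<close> matrix \<open>(\<Omega>, 1)\<close>.
  By Cauchy-Binet their vanishing minor is a combination of the \<open>2\<close> by \<open>2\<close> minors of \<open>(\<Omega>, 1)\<close>,
  with the Pluecker coordinates of the two integral rows as coefficients.
\<close>

lemma diagonalizable_imp_singular_relation:
  fixes \<Omega> :: "complex^2^2"
  assumes Sp: "block_matrix A B C D \<in> Sp2Z" and Om: "\<Omega> \<in> siegel_space"
    and diag: "diagonal_matrix (symplectic_action A B C D \<Omega>)"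
  obtains a b c d e :: int where "b\<^sup>2 - 4 * a * c - 4 * d * e = 1"
    and "of_int a * \<Omega> $ 1 $ 1 + of_int b * \<Omega> $ 1 $ 2 + of_int c * \<Omega> $ 2 $ 2
       + of_int d * ((\<Omega> $ 1 $ 2)\<^sup>2 - \<Omega> $ 1 $ 1 * \<Omega> $ 2 $ 2) + of_int e = 0"
proof -
  define X where "X = map_matrix of_int A ** \<Omega> + map_matrix of_int B"
  define N where "N = map_matrix of_int C ** \<Omega> + map_matrix of_int D"
  define Z where "Z = symplectic_action A B C D \<Omega>"
  have sym: "\<Omega> $ 2 $ 1 = \<Omega> $ 1 $ 2"
    using Om by (auto simp: siegel_space_def transpose_def vec_eq_iff)
  have "invertible N"
    using symplectic_denominator_invertible[OF Sp Om] by (simp add: N_def)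
  then have "matrix_inv N ** N = mat 1"
    unfolding invertible_def by (metis matrix_inv_eqI)
  then have "X = Z ** N"
    by (simp add: Z_def symplectic_action_def X_def N_def matrix_mul_assoc[symmetric])
  moreover have "Z $ 1 $ 2 = 0"
    using diag by (simp add: Z_def diagonal_matrix_def)
  ultimately have "X $ 1 $ j = Z $ 1 $ 1 * N $ 1 $ j" for j
    by (simp add: matrix_matrix_mult_def sum_2)
  then have minor: "X $ 1 $ 1 * N $ 1 $ 2 - X $ 1 $ 2 * N $ 1 $ 1 = 0"
    by simp
  \<comment> \<open>Pluecker coordinates of the first and third rows \<open>(A\<^sub>1, B\<^sub>1)\<close> and \<open>(C\<^sub>1, D\<^sub>1)\<close>\<close>
  let ?p12 = "A$1$1 * C$1$2 - A$1$2 * C$1$1"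
  let ?p13 = "A$1$1 * D$1$1 - B$1$1 * C$1$1"
  let ?p14 = "A$1$1 * D$1$2 - B$1$2 * C$1$1"
  let ?p23 = "A$1$2 * D$1$1 - B$1$1 * C$1$2"
  let ?p24 = "A$1$2 * D$1$2 - B$1$2 * C$1$2"
  let ?p34 = "B$1$1 * D$1$2 - B$1$2 * D$1$1"
  have "(A ** transpose D - B ** transpose C) $ 1 $ 1 = 1"
    unfolding symplectic_rows[OF Sp] by (simp add: mat_def)
  then have pairing: "?p13 + ?p24 = 1"
    by (simp add: matrix_matrix_mult_def transpose_def sum_2)
  \<comment> \<open>the Pluecker relation \<open>p12 p34 - p13 p24 + p14 p23 = 0\<close>\<close>
  have "(?p24 - ?p13)\<^sup>2 - 4 * ?p14 * (- ?p23) - 4 * (- ?p12) * ?p34 = (?p13 + ?p24)\<^sup>2"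
    by (simp add: power2_eq_square algebra_simps)
  then have "(?p24 - ?p13)\<^sup>2 - 4 * ?p14 * (- ?p23) - 4 * (- ?p12) * ?p34 = 1"
    using pairing by simp
  moreover have "of_int ?p14 * \<Omega> $ 1 $ 1 + of_int (?p24 - ?p13) * \<Omega> $ 1 $ 2
      + of_int (- ?p23) * \<Omega> $ 2 $ 2
      + of_int (- ?p12) * ((\<Omega> $ 1 $ 2)\<^sup>2 - \<Omega> $ 1 $ 1 * \<Omega> $ 2 $ 2) + of_int ?p34 = 0"
    using minor
    by (simp add: X_def N_def matrix_matrix_mult_def sum_2 sym power2_eq_square algebra_simps)
  ultimately show thesis
    by (rule that)
qed

section \<open>The quadratic equation on the image of the embedding\<close>

text \<open>
  A non-real root makes the discriminant \<open>4 ((a - c)\<^sup>2 + (b + d)\<^sup>2 - 1)\<close> of the quadratic equation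
  negative. The sum of the two integer squares is then less than \<open>1\<close>, so both vanish.
\<close>

lemma singular_relation_iota:
  fixes a b c d e :: int
  assumes "\<tau> \<in> upper_half_plane"
    and disc: "b\<^sup>2 - 4 * a * c - 4 * d * e = 1"
    and rel: "of_int a * iota \<tau> $ 1 $ 1 + of_int b * iota \<tau> $ 1 $ 2 + of_int c * iota \<tau> $ 2 $ 2
       + of_int d * ((iota \<tau> $ 1 $ 2)\<^sup>2 - iota \<tau> $ 1 $ 1 * iota \<tau> $ 2 $ 2) + of_int e = 0"
  shows "d \<noteq> 0" and "d * (d - 4 * e) = 4 * a\<^sup>2 + 1"
    and "of_int d * \<tau>\<^sup>2 - 4 * of_int a * \<tau> + of_int (d - 4 * e) = 0"
proof -
  define x y where "x = Re \<tau>" and "y = Im \<tau>"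
  have y: "y > 0"
    using assms(1) by (simp add: y_def upper_half_plane_def)
  have "of_int d * \<tau>\<^sup>2 - 2 * of_int (a + c) * \<tau> - of_int (2 * b + d + 4 * e) =
      - 4 * (of_int a * iota \<tau> $ 1 $ 1 + of_int b * iota \<tau> $ 1 $ 2 + of_int c * iota \<tau> $ 2 $ 2
       + of_int d * ((iota \<tau> $ 1 $ 2)\<^sup>2 - iota \<tau> $ 1 $ 1 * iota \<tau> $ 2 $ 2) + of_int e)"
    by (simp add: iota_def field_simps power2_eq_square)
  then have quad: "of_int d * \<tau>\<^sup>2 - 2 * of_int (a + c) * \<tau> - of_int (2 * b + d + 4 * e) = 0"
    unfolding rel by simp
  have im: "d * x = a + c"
  proof -
    have "y * (d * x) = y * (a + c)"
      using arg_cong[OF quad, of Im] by (simp add: x_def y_def power2_eq_square algebra_simps)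
    then show ?thesis using y by simp
  qed
  have re: "d * (x\<^sup>2 - y\<^sup>2) - 2 * real_of_int (a + c) * x = 2 * b + d + 4 * e"
    using arg_cong[OF quad, of Re] by (simp add: x_def y_def power2_eq_square algebra_simps)
  show "d \<noteq> 0"
  proof
    assume "d = 0"
    then have ac: "real_of_int (a + c) = 0"
      using im by simp
    then have "real_of_int (2 * b + 4 * e) = 0"
      using re \<open>d = 0\<close> by (simp only: ac)
    with ac have "2 * b + 4 * e = 0" and "a + c = 0"
      by (simp_all only: of_int_eq_0_iff)
    then have "b = - 2 * e" and "c = - a"
      by simp_all
    \<comment> \<open>a degenerate equation makes \<open>b\<close> even, against \<open>b\<^sup>2 - 4ac = 1\<close>\<close>
    then have "2 * (2 * e\<^sup>2 + 2 * a\<^sup>2) = 1"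
      using disc \<open>d = 0\<close> by (simp add: power2_eq_square)
    then show False by presburger
  qed
  \<comment> \<open>a quarter of the discriminant, evaluated once at the root and once by the discriminant relation\<close>
  have "real_of_int ((a + c)\<^sup>2 + d * (2 * b + d + 4 * e)) = (d * x)\<^sup>2 + d * (d * (x\<^sup>2 - y\<^sup>2) - 2 * (d * x) * x)"
    using re im by simp
  also have "\<dots> = - (d * y)\<^sup>2"
    by (simp add: power2_eq_square algebra_simps)
  also have "\<dots> < 0"
    using y \<open>d \<noteq> 0\<close> by simp
  finally have "(a + c)\<^sup>2 + d * (2 * b + d + 4 * e) < 0"
    by (simp only: of_int_less_0_iff)
  moreover have "(a + c)\<^sup>2 + d * (2 * b + d + 4 * e) = (a - c)\<^sup>2 + (b + d)\<^sup>2 - 1"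
    using disc by (simp add: power2_eq_square algebra_simps)
  ultimately have "(a - c)\<^sup>2 + (b + d)\<^sup>2 = 0"
    using sum_power2_ge_zero[of "a - c" "b + d"] by linarith
  then have "c = a" and "b = - d"
    by simp_all
  then show "d * (d - 4 * e) = 4 * a\<^sup>2 + 1"
    and "of_int d * \<tau>\<^sup>2 - 4 * of_int a * \<tau> + of_int (d - 4 * e) = 0"
    using disc quad by (simp_all add: power2_eq_square algebra_simps)
qed

section \<open>Reduction under the theta group\<close>

text \<open>
  Gauss reduction of the form \<open>d \<tau>\<^sup>2 - 4a \<tau> + e\<close> by descent on \<open>d\<close>. A translation by an even integer
  brings \<open>2a\<close> into the range below \<open>d\<close> in absolute value; then the last coefficient is smaller
  than \<open>d\<close>, and \<open>-1/\<tau>\<close> exchanges the two. Even translations suffice for this because \<open>d\<close> is odd: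
  the boundary case of \<open>2a\<close> equal to \<open>d\<close> or \<open>-d\<close> cannot occur. The conclusion is in cross-multiplied form: the
  theta group element with entries \<open>p\<close>, \<open>q\<close>, \<open>r\<close>, \<open>s\<close> maps \<open>\<tau>\<close> to \<open>\<i>\<close>.
\<close>

lemma theta_group_reduction:
  fixes a d e :: int
  assumes "Im \<tau> > 0" and "d > 0" and "d * e = 4 * a\<^sup>2 + 1"
    and "of_int d * \<tau>\<^sup>2 - 4 * of_int a * \<tau> + of_int e = 0"
  shows "\<exists>p q r s :: int. p * s - q * r = 1 \<and> even (p - s) \<and> even (q - r) \<and>
    of_int p * \<tau> + of_int q = \<i> * (of_int r * \<tau> + of_int s)"
  using assms
proof (induction "nat d" arbitrary: a d e \<tau> rule: less_induct)
  case less
  show ?case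
  proof (cases "d = 1")
    case True
    then have "(\<tau> - 2 * of_int a)\<^sup>2 = \<i>\<^sup>2"
      using less.prems by (simp add: power2_eq_square algebra_simps)
    then have "\<tau> - 2 * of_int a = \<i> \<or> \<tau> - 2 * of_int a = - \<i>"
      by (simp only: power2_eq_iff)
    moreover have "\<tau> - 2 * of_int a \<noteq> - \<i>"
      using less.prems(1) by (auto simp: complex_eq_iff)
    ultimately have "of_int 1 * \<tau> + of_int (- 2 * a) = \<i> * (of_int 0 * \<tau> + of_int 1)"
      by simp
    then show ?thesis
      by (intro exI[of _ 1] exI[of _ "- 2 * a"] exI[of _ 0] exI[of _ 1]) simp
  next
    case False
    \<comment> \<open>\<open>k\<close> is chosen so that \<open>2 (a + k d)\<close> is the residue of \<open>2a\<close> modulo \<open>2d\<close> in \<open>[-d, d)\<close>\<close>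
    define k where "k = - ((2 * a + d) div (2 * d))"
    define a' where "a' = a + k * d"
    define e' where "e' = e + 8 * a * k + 4 * k\<^sup>2 * d"
    have de': "d * e' = 4 * a'\<^sup>2 + 1"
      using less.prems(3) by (simp add: a'_def e'_def power2_eq_square algebra_simps)
    have "2 * a' + d = (2 * a + d) mod (2 * d)"
      unfolding a'_def k_def by (simp add: minus_div_mult_eq_mod[symmetric] algebra_simps)
    then have bounds: "0 \<le> 2 * a' + d" "2 * a' + d < 2 * d"
      using less.prems(2) by simp_all
    \<comment> \<open>the endpoint \<open>-d\<close> is excluded by parity, which makes the descent strict\<close>
    have "odd (d * e')"
      unfolding de' by simp
    then have "odd d"
      by simp
    then have "2 * a' + d \<noteq> 0"
      by presburger
    then have "\<bar>2 * a'\<bar> \<le> d - 1"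
      using bounds by linarith
    then have "(2 * a')\<^sup>2 \<le> (d - 1)\<^sup>2"
      by (metis abs_ge_zero power2_abs power_mono)
    then have "d * e' \<le> (d - 1)\<^sup>2 + 1"
      by (simp add: de' power2_eq_square)
    also have "\<dots> < d * d"
      using less.prems(2) False by (simp add: power2_eq_square algebra_simps)
    finally have "e' < d"
      using less.prems(2) by simp
    have "d * e' > 0"
      unfolding de' by (simp add: add_nonneg_pos)
    then have "e' > 0"
      using less.prems(2) by (simp add: zero_less_mult_iff)
    define \<sigma> where "\<sigma> = \<tau> + 2 * of_int k"
    have "Im \<sigma> > 0"
      using less.prems(1) by (simp add: \<sigma>_def)
    then have "\<sigma> \<noteq> 0"
      by auto
    have "Im (- 1 / \<sigma>) > 0"
      using \<open>Im \<sigma> > 0\<close> by (simp add: Im_divide add_nonneg_pos)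
    have "of_int d * \<sigma>\<^sup>2 - 4 * of_int a' * \<sigma> + of_int e' = 0"
      using less.prems(4) by (simp add: \<sigma>_def a'_def e'_def power2_eq_square algebra_simps)
    then have "of_int e' * (- 1 / \<sigma>)\<^sup>2 - 4 * of_int (- a') * (- 1 / \<sigma>) + of_int d = 0"
      using \<open>\<sigma> \<noteq> 0\<close> by (simp add: field_simps power2_eq_square)
    moreover have "e' * d = 4 * (- a')\<^sup>2 + 1"
      using de' by (simp add: mult.commute)
    moreover have "nat e' < nat d"
      using \<open>e' < d\<close> \<open>e' > 0\<close> by simp
    ultimately obtain p q r s :: int where pqrs:
      "p * s - q * r = 1" "even (p - s)" "even (q - r)"
      "of_int p * (- 1 / \<sigma>) + of_int q = \<i> * (of_int r * (- 1 / \<sigma>) + of_int s)"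
      using less.hyps \<open>Im (- 1 / \<sigma>) > 0\<close> \<open>e' > 0\<close> by blast
    have "of_int q * \<sigma> - of_int p = \<i> * (of_int s * \<sigma> - of_int r)"
      using pqrs(4) \<open>\<sigma> \<noteq> 0\<close> by (simp add: field_simps)
    then have "of_int q * \<tau> + of_int (2 * k * q - p) = \<i> * (of_int s * \<tau> + of_int (2 * k * s - r))"
      by (simp add: \<sigma>_def algebra_simps)
    moreover have "q * (2 * k * s - r) - (2 * k * q - p) * s = 1"
      using pqrs(1) by (simp add: algebra_simps)
    moreover have "even (q - (2 * k * s - r))" "even ((2 * k * q - p) - s)"
      using pqrs(2,3) by auto
    ultimately show ?thesis
      by blast
  qed
qed

text \<open>
  Conjugation by \<open>g0\<close> is the Cayley transform: the matrix of \<open>SU(1,1)\<close> with first row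
  \<open>(x + \<i> l, m + \<i> k)\<close> becomes the real matrix with rows \<open>(x + k, m + l)\<close> and \<open>(m - l, x - k)\<close>.
  For Gaussian integers the entries satisfy exactly the parity conditions of the theta group, and
  conversely these conditions make the half sums and half differences integral.
\<close>

lemma theta_group_subset_G:
  fixes p q r s :: int
  assumes "p * s - q * r = 1" and "even (p - s)" and "even (q - r)"
  shows "vector [vector [of_int p, of_int q], vector [of_int r, of_int s]] \<in> G"
proof -
  obtain k l where kl: "p - s = 2 * k" "q - r = 2 * l"
    using assms(2,3) unfolding dvd_def by blast
  define x m where "x = p - k" and "m = q - l"
  have pqrs: "p = x + k" "s = x - k" "q = m + l" "r = m - l"
    using kl by (simp_all add: x_def m_def)
  let ?a = "Complex x l" and ?b = "Complex m k"
  define u :: "complex^2^2" where "u = vector [vector [?a, ?b], vector [cnj ?b, cnj ?a]]"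
  have "x\<^sup>2 + l\<^sup>2 - m\<^sup>2 - k\<^sup>2 = 1"
    using assms(1) by (simp add: pqrs power2_eq_square algebra_simps)
  then have "real_of_int (x\<^sup>2 + l\<^sup>2 - m\<^sup>2 - k\<^sup>2) = 1"
    by (simp only: of_int_1)
  then have "u \<in> U11_gaussian"
    by (simp add: U11_gaussian_def gaussian_integers_def u_def H11_def vec_eq_iff forall_2
        transpose_def matrix_matrix_mult_def sum_2 complex_eq_iff power2_eq_square algebra_simps)
  moreover have sqrt2: "sqrt 2 * (sqrt 2 * z) = 2 * z" for z :: real
    by (simp flip: mult.assoc)
  moreover have "g0 ** u ** matrix_inv g0 = vector [vector [of_int p, of_int q], vector [of_int r, of_int s]]"
    unfolding matrix_inv_g0 unfolding g0_def
    by (simp add: u_def pqrs vec_eq_iff forall_2 matrix_matrix_mult_def sum_2 complex_eq_iff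
        field_simps sqrt2)
  ultimately show ?thesis
    unfolding G_def by (metis (mono_tags, lifting) mem_Collect_eq)
qed

theorem proposition8:
  fixes \<tau> :: complex
  assumes "\<tau> \<in> upper_half_plane"
    and "\<exists>A B C D. block_matrix A B C D \<in> Sp2Z \<and>
           diagonal_matrix (symplectic_action A B C D (iota \<tau>))"
  shows "\<exists>g\<in>G. iota (frac_linear g \<tau>) = iota \<i>"
proof -
  have pos: "Im \<tau> > 0"
    using assms(1) by (simp add: upper_half_plane_def)
  obtain A B C D where "block_matrix A B C D \<in> Sp2Z"
    and "diagonal_matrix (symplectic_action A B C D (iota \<tau>))"
    using assms(2) by blast
  then obtain a b c d e :: int where "b\<^sup>2 - 4 * a * c - 4 * d * e = 1"
    and "of_int a * iota \<tau> $ 1 $ 1 + of_int b * iota \<tau> $ 1 $ 2 + of_int c * iota \<tau> $ 2 $ 2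
       + of_int d * ((iota \<tau> $ 1 $ 2)\<^sup>2 - iota \<tau> $ 1 $ 1 * iota \<tau> $ 2 $ 2) + of_int e = 0"
    by (rule diagonalizable_imp_singular_relation[OF _ iota_in_siegel_space[OF assms(1)]])
  note form = singular_relation_iota[OF assms(1) this]
  \<comment> \<open>multiplying the form by the sign of \<open>d\<close> makes it positive definite\<close>
  define \<epsilon> where "\<epsilon> = sgn d"
  have "\<epsilon> * d > 0" and sq: "\<epsilon> * \<epsilon> = 1"
    using form(1) by (auto simp: \<epsilon>_def sgn_if)
  moreover have "(\<epsilon> * d) * (\<epsilon> * (d - 4 * e)) = 4 * (\<epsilon> * a)\<^sup>2 + 1"
  proof -
    have "(\<epsilon> * d) * (\<epsilon> * (d - 4 * e)) = (\<epsilon> * \<epsilon>) * (d * (d - 4 * e))"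
      by (simp only: mult_ac)
    also have "\<dots> = (\<epsilon> * \<epsilon>) * (4 * a\<^sup>2) + 1"
      by (simp add: form(2) sq)
    finally show ?thesis
      by (simp add: power2_eq_square mult_ac)
  qed
  moreover have "of_int (\<epsilon> * d) * \<tau>\<^sup>2 - 4 * of_int (\<epsilon> * a) * \<tau> + of_int (\<epsilon> * (d - 4 * e)) = 0"
    using arg_cong[OF form(3), of "\<lambda>z. of_int \<epsilon> * z"] by (simp add: algebra_simps)
  ultimately have "\<exists>p q r s :: int. p * s - q * r = 1 \<and> even (p - s) \<and> even (q - r) \<and>
    of_int p * \<tau> + of_int q = \<i> * (of_int r * \<tau> + of_int s)"
    by (intro theta_group_reduction[OF pos])
  then obtain p q r s :: int where pqrs:
    "p * s - q * r = 1" "even (p - s)" "even (q - r)"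
    "of_int p * \<tau> + of_int q = \<i> * (of_int r * \<tau> + of_int s)"
    by blast
  \<comment> \<open>the denominator of the fractional linear map cannot vanish, as the determinant is \<open>1\<close>\<close>
  have "of_int p * (of_int r * \<tau> + of_int s) - of_int r * (of_int p * \<tau> + of_int q)
      = (of_int (p * s - q * r) :: complex)"
    by (simp add: algebra_simps)
  then have "of_int r * \<tau> + of_int s \<noteq> 0"
    using pqrs(1,4) by auto
  then have "frac_linear (vector [vector [of_int p, of_int q], vector [of_int r, of_int s]]) \<tau> = \<i>"
    by (simp add: frac_linear_def moebius_def pqrs(4))
  then show ?thesis
    by (intro bexI[OF _ theta_group_subset_G[OF pqrs(1-3)]]) simp
qed

end
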